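(* Let $\alpha\in[0,1]^{\mathbb N}$ be rationally independent, let $\omega>0$, $\rho_0>0$, $\iota>0$, and let the spaces $\mathscr A_\rho$, $\mathscr A^m_\rho$, the norms $\|\cdot\|_\rho$, the operator $\partial_\alpha$, the average $\langle\cdot\rangle$ and the functional $\mathcal E$ be as in the context. Let $\hat h\in\mathscr A^1_{\rho_0}$ be real-valued on $\mathbb T^{\mathbb N}$ with $\hat h_0=0$ (zero average), and let $\widehat V:\mathbb T^{\mathbb N}\to\mathbb R$ satisfy $\partial_\alpha\widehat V\in\mathscr A^2_{\rho_0+\|\hat h\|_{\rho_0}+\iota}$. Put $\hat l=1+\partial_\alpha\hat h$ and $T_x(\sigma)=\sigma+x$. Assume: (Diophantine condition) there are $\tau,\nu>0$ such that for all $k\in\mathbb Z^{\mathbb N}_*\setminus\{0\}$ and all $n\in\mathbb Z$, $$|\omega\alpha\cdot k-2n\pi|\ge\frac{\nu}{\prod_{j\in\mathbb N}\left(1+\langle\langle j\rangle\rangle^{1+\tau}|k_j|^{1+\tau}\right)};$$ (Non-degeneracy condition) there are constants $N^+,N^-,c>0$ with $\|\hat l\|_{\rho_0}\le N^+$, $\|\hat l^{-1}\|_{\rho_0}\le N^-$ (where $\hat l^{-1}=1/\hat l$), and $\left|\left\langle\frac{1}{\hat l\cdot\hat l\circ T_{-\omega\alpha}}\right\rangle\right|\ge c$; (Smallness) $\|\mathcal E[\hat h]\|_{\rho_0}\le\epsilon\le\epsilon^*$, where $\epsilon^*>0$ is the threshold of the KAM theorem recalled in the context (it depends only on $N^+,N^-,c,\tau,\nu,\iota,\rho_0$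 and $\|\partial_\alpha\widehat V\|_{\mathscr A^2_{\rho_0+\|\hat h\|_{\rho_0}+\iota}}$). Let $\hat h^*\in\mathscr A_{\rho_0/2}$ be the solution of $\mathcal E[\hat h^*]=0$ provided by that KAM theorem, and let $V(\theta)=\widehat V(\theta\alpha)$ for $\theta\in\mathbb R$. Then the configuration $$u_n=n\omega+\hat h^*(n\omega\alpha),\qquad n\in\mathbb Z,$$ which is an equilibrium of the Frenkel-Kontorova energy $\Phi(u)=\sum_{n\in\mathbb Z}\left[\tfrac12(u_n-u_{n+1})^2+V(u_n)\right]$, does not have a phonon gap; that is, the bounded operator $D^2\Phi(u):\ell^2(\mathbb Z)\to\ell^2(\mathbb Z)$, $$(D^2\Phi(u)\xi)_n=-\xi_{n-1}+(2+V''(u_n))\xi_n-\xi_{n+1},$$ is not invertible in the space of bounded linear operators on $\ell^2(\mathbb Z)$ (equivalently, $0\in\sigma(D^2\Phi(u))$).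
   Context: Notation. $\mathbb T=\mathbb R/2\pi\mathbb Z$. $\mathbb N=\{1,2,\dots\}$ and $\langle\langle j\rangle\rangle=\max\{1,|j|\}$. $\mathbb Z^{\mathbb N}_*$ is the set of $k\in\mathbb Z^{\mathbb N}$ with finitely many nonzero entries, and $k\cdot x=\sum_j k_jx_j$. A vector $\alpha\in\mathbb R^{\mathbb N}$ is rationally independent if $k\cdot\alpha\ne0$ for all $k\in\mathbb Z^{\mathbb N}_*\setminus\{0\}$. For $\theta\in\mathbb R$, $\theta\alpha$ is regarded as a point of $\mathbb T^{\mathbb N}$. Function spaces. Fix $\eta>0$ and let $|k|_\eta=\sum_j\langle\langle j\rangle\rangle^{\eta}|k_j|$. For $\rho>0$, $\mathscr A_\rho$ is the Banach space of functions $\hat g(\sigma)=\sum_{k\in\mathbb Z^{\mathbb N}_*}\hat g_ke^{ik\cdot\sigma}$ on $\mathbb T^{\mathbb N}$ with $\|\hat g\|_\rho=\sum_k|\hat g_k|e^{\rho|k|_\eta}<\infty$. These are analytic functions on a thickened infinite-dimensional torus. The directional derivative is $\partial_\alpha\hat g(\sigma)=\frac{d}{dt}\hat g(\sigma+t\alpha)|_{t=0}=\sum_k i(k\cdot\alpha)\hat g_ke^{ik\cdot\sigma}$. $\mathscr A^m_\rho$ is the space of $\hat g\in\mathscr A_\rho$ whose derivatives $\partial_\alpha^j\hat g$, $0\le j\le m$, lie in $\mathscr A_\rho$, with norm $\|\hat g\|_{\mathscr A^m_\rho}=\max_{0\le j\le m}\|\partial_\alpha^j\hat g\|_\rho$.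 The average is $\langle\hat g\rangle=\hat g_0$ (the integral against normalized Haar measure on $\mathbb T^{\mathbb N}$). All functions $\hat h,\hat h^*,\widehat V$ are real-valued on $\mathbb T^{\mathbb N}$. Equilibrium equation. For $\hat g:\mathbb T^{\mathbb N}\to\mathbb R$, $$\mathcal E[\hat g](\sigma)=\hat g(\sigma+\omega\alpha)+\hat g(\sigma-\omega\alpha)-2\hat g(\sigma)-(\partial_\alpha\widehat V)(\sigma+\alpha\,\hat g(\sigma)),\qquad\sigma\in\mathbb T^{\mathbb N}.$$ If $\mathcal E[\hat h^*]=0$, then $u_n=n\omega+\hat h^*(n\omega\alpha)$ satisfies $u_{n+1}+u_{n-1}-2u_n-V'(u_n)=0$ for all $n\in\mathbb Z$, i.e. $u$ is an equilibrium: $D\Phi(u)=0$, the formal derivative of $\Phi$ with respect to every $u_n$ vanishes. Known KAM theorem (from earlier work; it may be taken as given). Under the Diophantine and non-degeneracy conditions in the claim there are $\epsilon^*,C_1,C_3>0$, depending only on $N^+,N^-,c,\tau,\nu,\iota,\rho_0,\|\partial_\alpha\widehat V\|_{\mathscr A^2_{\rho_0+\|\hat h\|_{\rho_0}+\iota}}$, such that if $\|\mathcal E[\hat h]\|_{\rho_0}\le\epsilon\le\epsilon^*$, then there is an analytic $\hat h^*\in\mathscr A_{\rho_0/2}$ with $\mathcal E[\hat h^*]=0$ and $\|\hat h-\hat h^*\|_{\rho_0/2}\le C_1\epsilon$; moreover $\hat h^*$ is the unique solution of $\mathcal E[\hat g]=0$ in the set $\{\hat g\in\mathscr A_{\frac38\rho_0}:\langle\hat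 g\rangle=0,\ \|\hat g-\hat h\|_{\frac38\rho_0}\le C_3\}$. Phonon gap. An equilibrium $u$ has a phonon gap if $0\notin\sigma(D^2\Phi(u))$, i.e. $D^2\Phi(u):\ell^2(\mathbb Z)\to\ell^2(\mathbb Z)$ is invertible with bounded inverse. *)

theory Defs
  imports "HOL-Probability.Probability"
begin

text \<open>
  Points of the torus \<open>(\<real>/2\<pi>\<int>)\<^sup>N\<close>, \<open>N = {1,2,...}\<close>, are represented by real sequences
  \<open>\<sigma> :: nat \<Rightarrow> real\<close>, and functions on the torus by functions on sequences that are \<open>2\<pi>\<close>-periodic
  in the coordinates.  The coordinate with index \<open>j :: nat\<close> stands for the one with index
  \<open>j + 1\<close> in \<open>N\<close>; this shift is only visible in the weights \<open>jweight\<close>.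
\<close>

definition jweight :: "nat \<Rightarrow> real" where
  "jweight j = max 1 \<bar>real (Suc j)\<bar>"

definition Zfin :: "(nat \<Rightarrow> int) set" where
  "Zfin = {k. finite {j. k j \<noteq> 0}}"

definition kdot :: "(nat \<Rightarrow> int) \<Rightarrow> (nat \<Rightarrow> real) \<Rightarrow> real" where
  "kdot k x = (\<Sum>j | k j \<noteq> 0. real_of_int (k j) * x j)"

definition knorm :: "real \<Rightarrow> (nat \<Rightarrow> int) \<Rightarrow> real" where
  "knorm \<eta> k = (\<Sum>j | k j \<noteq> 0. jweight j powr \<eta> * real_of_int \<bar>k j\<bar>)"

definition rationally_independent :: "(nat \<Rightarrow> real) \<Rightarrow> bool" where
  "rationally_independent \<alpha> \<longleftrightarrow> (\<forall>k\<in>Zfin - {\<lambda>_. 0}. kdot k \<alpha> \<noteq> 0)"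

definition torus_periodic :: "((nat \<Rightarrow> real) \<Rightarrow> 'a) \<Rightarrow> bool" where
  "torus_periodic g \<longleftrightarrow> (\<forall>\<sigma> (m :: nat \<Rightarrow> int). g (\<lambda>j. \<sigma> j + 2 * pi * real_of_int (m j)) = g \<sigma>)"

text \<open>\<open>along \<alpha> t \<sigma>\<close> is the point \<open>\<sigma> + t \<alpha>\<close>.\<close>

definition along :: "(nat \<Rightarrow> real) \<Rightarrow> real \<Rightarrow> (nat \<Rightarrow> real) \<Rightarrow> (nat \<Rightarrow> real)" where
  "along \<alpha> t \<sigma> = (\<lambda>j. \<sigma> j + t * \<alpha> j)"

text \<open>Normalized Haar measure of the torus, carried by the fundamental domain \<open>[0,2\<pi>)\<^sup>N\<close>.\<close>

definition haar :: "(nat \<Rightarrow> real) measure" where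
  "haar = (\<Pi>\<^sub>M j\<in>UNIV. uniform_measure lborel {0..<2 * pi})"

definition torus_avg :: "((nat \<Rightarrow> real) \<Rightarrow> 'a) \<Rightarrow> 'a::{banach, second_countable_topology}" where
  "torus_avg g = (LINT \<sigma>|haar. g \<sigma>)"

text \<open>
  The coefficients of an absolutely convergent series \<open>g \<sigma> = \<Sum>\<^sub>k c\<^sub>k e\<^sup>i\<^sup>k\<^sup>\<sigma>\<close> are the Fourier
  coefficients of \<open>g\<close>; in particular the coefficient at \<open>k = 0\<close> is the average.
\<close>

definition fourier_coeff :: "((nat \<Rightarrow> real) \<Rightarrow> complex) \<Rightarrow> (nat \<Rightarrow> int) \<Rightarrow> complex" where
  "fourier_coeff g k = torus_avg (\<lambda>\<sigma>. g \<sigma> * cis (- kdot k \<sigma>))"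

definition A_space :: "real \<Rightarrow> real \<Rightarrow> ((nat \<Rightarrow> real) \<Rightarrow> complex) set" where
  "A_space \<eta> \<rho> = {g.
     (\<lambda>k. cmod (fourier_coeff g k) * exp (\<rho> * knorm \<eta> k)) summable_on Zfin \<and>
     (\<forall>\<sigma>. ((\<lambda>k. fourier_coeff g k * cis (kdot k \<sigma>)) has_sum g \<sigma>) Zfin)}"

text \<open>Only meaningful on \<open>A_space \<eta> \<rho>\<close>.\<close>

definition A_norm :: "real \<Rightarrow> real \<Rightarrow> ((nat \<Rightarrow> real) \<Rightarrow> complex) \<Rightarrow> real" where
  "A_norm \<eta> \<rho> g = (\<Sum>\<^sub>\<infinity>k\<in>Zfin. cmod (fourier_coeff g k) * exp (\<rho> * knorm \<eta> k))"

definition dir_differentiable ::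
  "(nat \<Rightarrow> real) \<Rightarrow> ((nat \<Rightarrow> real) \<Rightarrow> 'a::real_normed_vector) \<Rightarrow> bool" where
  "dir_differentiable \<alpha> g \<longleftrightarrow> (\<forall>\<sigma>. (\<lambda>t. g (along \<alpha> t \<sigma>)) differentiable (at 0))"

definition dir_deriv ::
  "(nat \<Rightarrow> real) \<Rightarrow> ((nat \<Rightarrow> real) \<Rightarrow> 'a::real_normed_vector) \<Rightarrow> (nat \<Rightarrow> real) \<Rightarrow> 'a" where
  "dir_deriv \<alpha> g \<sigma> = vector_derivative (\<lambda>t. g (along \<alpha> t \<sigma>)) (at 0)"

text \<open>
  For \<open>\<rho> > 0\<close> and \<open>\<alpha> \<in> [0,1]\<^sup>N\<close> the elements of \<open>A_space \<eta> \<rho>\<close> are differentiable in direction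
  \<open>\<alpha>\<close>, so no differentiability clause is needed here.
\<close>

definition A_space_m ::
  "real \<Rightarrow> (nat \<Rightarrow> real) \<Rightarrow> nat \<Rightarrow> real \<Rightarrow> ((nat \<Rightarrow> real) \<Rightarrow> complex) set" where
  "A_space_m \<eta> \<alpha> m \<rho> = {g \<in> A_space \<eta> \<rho>. \<forall>j\<le>m. (dir_deriv \<alpha> ^^ j) g \<in> A_space \<eta> \<rho>}"

definition A_norm_m ::
  "real \<Rightarrow> (nat \<Rightarrow> real) \<Rightarrow> nat \<Rightarrow> real \<Rightarrow> ((nat \<Rightarrow> real) \<Rightarrow> complex) \<Rightarrow> real" where
  "A_norm_m \<eta> \<alpha> m \<rho> g = Max ((\<lambda>j. A_norm \<eta> \<rho> ((dir_deriv \<alpha> ^^ j) g)) ` {..m})"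

text \<open>
  The spaces consist of complex-valued functions.  Real-valued functions are kept as such
  and enter them through \<open>cplx\<close>.
\<close>

abbreviation cplx :: "((nat \<Rightarrow> real) \<Rightarrow> real) \<Rightarrow> (nat \<Rightarrow> real) \<Rightarrow> complex" where
  "cplx g \<equiv> \<lambda>\<sigma>. complex_of_real (g \<sigma>)"

definition equil_err ::
  "(nat \<Rightarrow> real) \<Rightarrow> real \<Rightarrow> ((nat \<Rightarrow> real) \<Rightarrow> real) \<Rightarrow> ((nat \<Rightarrow> real) \<Rightarrow> real) \<Rightarrow>
     (nat \<Rightarrow> real) \<Rightarrow> real" where
  "equil_err \<alpha> \<omega> V g \<sigma> =
     g (along \<alpha> \<omega> \<sigma>) + g (along \<alpha> (- \<omega>) \<sigma>) - 2 * g \<sigma> - dir_deriv \<alpha> V (along \<alpha> (g \<sigma>) \<sigma>)"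

text \<open>
  Continuity of \<open>V\<close> refers to the product topology.  It makes \<open>\<partial>\<^sub>\<alpha> V\<close> the derivative of a genuine
  function on the torus as a topological space: without it \<open>V\<close> could be chosen independently
  on each orbit of the flow \<open>\<sigma> \<mapsto> \<sigma> + t \<alpha>\<close>, and \<open>\<partial>\<^sub>\<alpha> V\<close> might have nonzero average.
\<close>

definition fk_setting ::
  "real \<Rightarrow> (nat \<Rightarrow> real) \<Rightarrow> real \<Rightarrow> real \<Rightarrow> real \<Rightarrow>
     ((nat \<Rightarrow> real) \<Rightarrow> real) \<Rightarrow> ((nat \<Rightarrow> real) \<Rightarrow> real) \<Rightarrow> bool" where
  "fk_setting \<eta> \<alpha> \<omega> \<rho>0 \<iota> h V \<longleftrightarrow>
     (\<forall>j. 0 \<le> \<alpha> j \<and> \<alpha> j \<le> 1) \<and> rationally_independent \<alpha> \<and>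
     \<omega> > 0 \<and> \<rho>0 > 0 \<and> \<iota> > 0 \<and>
     cplx h \<in> A_space_m \<eta> \<alpha> 1 \<rho>0 \<and> torus_avg h = 0 \<and>
     torus_periodic V \<and> continuous_on UNIV V \<and> dir_differentiable \<alpha> V \<and>
     cplx (dir_deriv \<alpha> V) \<in> A_space_m \<eta> \<alpha> 2 (\<rho>0 + A_norm \<eta> \<rho>0 (cplx h) + \<iota>)"

definition diophantine :: "(nat \<Rightarrow> real) \<Rightarrow> real \<Rightarrow> real \<Rightarrow> real \<Rightarrow> bool" where
  "diophantine \<alpha> \<omega> \<tau> \<nu> \<longleftrightarrow> \<tau> > 0 \<and> \<nu> > 0 \<and>
     (\<forall>k\<in>Zfin - {\<lambda>_. 0}. \<forall>n :: int.
        \<bar>\<omega> * kdot k \<alpha> - 2 * real_of_int n * pi\<bar> \<ge>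
          \<nu> / (\<Prod>j | k j \<noteq> 0. 1 + jweight j powr (1 + \<tau>) * real_of_int \<bar>k j\<bar> powr (1 + \<tau>)))"

definition lfun :: "(nat \<Rightarrow> real) \<Rightarrow> ((nat \<Rightarrow> real) \<Rightarrow> real) \<Rightarrow> (nat \<Rightarrow> real) \<Rightarrow> real" where
  "lfun \<alpha> h \<sigma> = 1 + dir_deriv \<alpha> h \<sigma>"

definition nondegenerate ::
  "real \<Rightarrow> (nat \<Rightarrow> real) \<Rightarrow> real \<Rightarrow> real \<Rightarrow> real \<Rightarrow> real \<Rightarrow> real \<Rightarrow>
     ((nat \<Rightarrow> real) \<Rightarrow> real) \<Rightarrow> bool" where
  "nondegenerate \<eta> \<alpha> \<omega> \<rho>0 Np Nm c h \<longleftrightarrow> Np > 0 \<and> Nm > 0 \<and> c > 0 \<and>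
     cplx (lfun \<alpha> h) \<in> A_space \<eta> \<rho>0 \<and> A_norm \<eta> \<rho>0 (cplx (lfun \<alpha> h)) \<le> Np \<and>
     (\<forall>\<sigma>. lfun \<alpha> h \<sigma> \<noteq> 0) \<and>
     cplx (\<lambda>\<sigma>. 1 / lfun \<alpha> h \<sigma>) \<in> A_space \<eta> \<rho>0 \<and>
     A_norm \<eta> \<rho>0 (cplx (\<lambda>\<sigma>. 1 / lfun \<alpha> h \<sigma>)) \<le> Nm \<and>
     \<bar>torus_avg (\<lambda>\<sigma>. 1 / (lfun \<alpha> h \<sigma> * lfun \<alpha> h (along \<alpha> (- \<omega>) \<sigma>)))\<bar> \<ge> c"

definition approx_solution ::
  "real \<Rightarrow> (nat \<Rightarrow> real) \<Rightarrow> real \<Rightarrow> real \<Rightarrow>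
     ((nat \<Rightarrow> real) \<Rightarrow> real) \<Rightarrow> ((nat \<Rightarrow> real) \<Rightarrow> real) \<Rightarrow> real \<Rightarrow> bool" where
  "approx_solution \<eta> \<alpha> \<omega> \<rho>0 h V \<epsilon> \<longleftrightarrow>
     cplx (equil_err \<alpha> \<omega> V h) \<in> A_space \<eta> \<rho>0 \<and>
     A_norm \<eta> \<rho>0 (cplx (equil_err \<alpha> \<omega> V h)) \<le> \<epsilon>"

definition kam_ball ::
  "real \<Rightarrow> real \<Rightarrow> ((nat \<Rightarrow> real) \<Rightarrow> real) \<Rightarrow> real \<Rightarrow> ((nat \<Rightarrow> real) \<Rightarrow> real) set" where
  "kam_ball \<eta> \<rho>0 h C3 = {g. cplx g \<in> A_space \<eta> (3/8 * \<rho>0) \<and> torus_avg g = 0 \<and>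
     A_norm \<eta> (3/8 * \<rho>0) (cplx (\<lambda>\<sigma>. g \<sigma> - h \<sigma>)) \<le> C3}"

text \<open>\<open>hs\<close> is the solution provided by the KAM theorem for the approximate solution \<open>h\<close>.\<close>

definition kam_solution ::
  "real \<Rightarrow> (nat \<Rightarrow> real) \<Rightarrow> real \<Rightarrow> real \<Rightarrow>
     ((nat \<Rightarrow> real) \<Rightarrow> real) \<Rightarrow> ((nat \<Rightarrow> real) \<Rightarrow> real) \<Rightarrow> real \<Rightarrow> real \<Rightarrow> real \<Rightarrow>
     ((nat \<Rightarrow> real) \<Rightarrow> real) \<Rightarrow> bool" where
  "kam_solution \<eta> \<alpha> \<omega> \<rho>0 h V \<epsilon> C1 C3 hs \<longleftrightarrow>
     cplx hs \<in> A_space \<eta> (\<rho>0 / 2) \<and>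
     (\<forall>\<sigma>. equil_err \<alpha> \<omega> V hs \<sigma> = 0) \<and>
     A_norm \<eta> (\<rho>0 / 2) (cplx (\<lambda>\<sigma>. h \<sigma> - hs \<sigma>)) \<le> C1 * \<epsilon> \<and>
     hs \<in> kam_ball \<eta> \<rho>0 h C3 \<and>
     (\<forall>g \<in> kam_ball \<eta> \<rho>0 h C3. (\<forall>\<sigma>. equil_err \<alpha> \<omega> V g \<sigma> = 0) \<longrightarrow> g = hs)"

text \<open>
  \<open>\<epsilon>s\<close>, \<open>C1\<close>, \<open>C3\<close> are admissible constants in the KAM theorem for the given parameters, \<open>M\<close>
  being the norm of \<open>\<partial>\<^sub>\<alpha> V\<close>.  The quantification over \<open>\<alpha>\<close>, \<open>\<omega>\<close>, \<open>h\<close>, \<open>V\<close> inside expresses that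
  the constants depend on the parameters only.
\<close>

definition kam_constants ::
  "real \<Rightarrow> real \<Rightarrow> real \<Rightarrow> real \<Rightarrow> real \<Rightarrow> real \<Rightarrow> real \<Rightarrow> real \<Rightarrow> real \<Rightarrow>
     real \<Rightarrow> real \<Rightarrow> real \<Rightarrow> bool" where
  "kam_constants \<eta> Np Nm c \<tau> \<nu> \<iota> \<rho>0 M \<epsilon>s C1 C3 \<longleftrightarrow> \<epsilon>s > 0 \<and> C1 > 0 \<and> C3 > 0 \<and>
     (\<forall>\<alpha> \<omega> h V \<epsilon>.
        fk_setting \<eta> \<alpha> \<omega> \<rho>0 \<iota> h V \<and>
        A_norm_m \<eta> \<alpha> 2 (\<rho>0 + A_norm \<eta> \<rho>0 (cplx h) + \<iota>) (cplx (dir_deriv \<alpha> V)) = M \<and>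
        diophantine \<alpha> \<omega> \<tau> \<nu> \<and>
        nondegenerate \<eta> \<alpha> \<omega> \<rho>0 Np Nm c h \<and>
        approx_solution \<eta> \<alpha> \<omega> \<rho>0 h V \<epsilon> \<and> \<epsilon> \<le> \<epsilon>s \<longrightarrow>
        (\<exists>hs. kam_solution \<eta> \<alpha> \<omega> \<rho>0 h V \<epsilon> C1 C3 hs))"

definition fk_site :: "(real \<Rightarrow> real) \<Rightarrow> (int \<Rightarrow> real) \<Rightarrow> int \<Rightarrow> real" where
  "fk_site V u n = 1/2 * (u n - u (n + 1))\<^sup>2 + V (u n)"

text \<open>
  The formal derivative of \<open>\<Phi> u = \<Sum>\<^sub>n fk_site V u n\<close> with respect to \<open>u n\<close> is the derivative of the
  sum of the two terms in which \<open>u n\<close> occurs.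
\<close>

definition fk_equilibrium :: "(real \<Rightarrow> real) \<Rightarrow> (int \<Rightarrow> real) \<Rightarrow> bool" where
  "fk_equilibrium V u \<longleftrightarrow>
     (\<forall>n. ((\<lambda>x. \<Sum>m\<in>{n - 1, n}. fk_site V (u(n := x)) m) has_real_derivative 0) (at (u n)))"

definition ell2 :: "(int \<Rightarrow> complex) set" where
  "ell2 = {x. (\<lambda>n. (cmod (x n))\<^sup>2) summable_on UNIV}"

definition ell2_norm :: "(int \<Rightarrow> complex) \<Rightarrow> real" where
  "ell2_norm x = sqrt (\<Sum>\<^sub>\<infinity>n. (cmod (x n))\<^sup>2)"

definition ell2_bounded_linear :: "((int \<Rightarrow> complex) \<Rightarrow> (int \<Rightarrow> complex)) \<Rightarrow> bool" where
  "ell2_bounded_linear T \<longleftrightarrow>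
     (\<forall>x\<in>ell2. T x \<in> ell2) \<and>
     (\<forall>x\<in>ell2. \<forall>y\<in>ell2. T (\<lambda>n. x n + y n) = (\<lambda>n. T x n + T y n)) \<and>
     (\<forall>a. \<forall>x\<in>ell2. T (\<lambda>n. a * x n) = (\<lambda>n. a * T x n)) \<and>
     (\<exists>K. \<forall>x\<in>ell2. ell2_norm (T x) \<le> K * ell2_norm x)"

text \<open>
  Invertibility in the algebra of bounded operators and the spectrum; intended for \<open>T\<close> with
  \<open>ell2_bounded_linear T\<close>.
\<close>

definition ell2_invertible :: "((int \<Rightarrow> complex) \<Rightarrow> (int \<Rightarrow> complex)) \<Rightarrow> bool" where
  "ell2_invertible T \<longleftrightarrow>
     (\<exists>S. ell2_bounded_linear S \<and> (\<forall>x\<in>ell2. S (T x) = x) \<and> (\<forall>x\<in>ell2. T (S x) = x))"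

definition ell2_spectrum :: "((int \<Rightarrow> complex) \<Rightarrow> (int \<Rightarrow> complex)) \<Rightarrow> complex set" where
  "ell2_spectrum T = {z. \<not> ell2_invertible (\<lambda>x n. T x n - z * x n)}"

definition fk_hessian ::
  "(real \<Rightarrow> real) \<Rightarrow> (int \<Rightarrow> real) \<Rightarrow> (int \<Rightarrow> complex) \<Rightarrow> (int \<Rightarrow> complex)" where
  "fk_hessian V u \<xi> n =
     - \<xi> (n - 1) + complex_of_real (2 + deriv (deriv V) (u n)) * \<xi> n - \<xi> (n + 1)"

definition phonon_gap :: "(real \<Rightarrow> real) \<Rightarrow> (int \<Rightarrow> real) \<Rightarrow> bool" where
  "phonon_gap V u \<longleftrightarrow> 0 \<notin> ell2_spectrum (fk_hessian V u)"

definition hull_config ::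
  "(nat \<Rightarrow> real) \<Rightarrow> real \<Rightarrow> ((nat \<Rightarrow> real) \<Rightarrow> real) \<Rightarrow> int \<Rightarrow> real" where
  "hull_config \<alpha> \<omega> g n = real_of_int n * \<omega> + g (\<lambda>j. real_of_int n * \<omega> * \<alpha> j)"

definition line_potential ::
  "(nat \<Rightarrow> real) \<Rightarrow> ((nat \<Rightarrow> real) \<Rightarrow> real) \<Rightarrow> real \<Rightarrow> real" where
  "line_potential \<alpha> V \<theta> = V (\<lambda>j. \<theta> * \<alpha> j)"

end

theory Submission
  imports Defs
begin

text \<open>
  The equilibrium belongs to a continuous family.  Along the line \<open>t \<mapsto> t \<alpha>\<close> the equation
  \<open>\<E>[h\<^sup>*] = 0\<close> says that, with \<open>H t = h\<^sup>*(t \<alpha>)\<close> and \<open>V\<close> restricted to that line,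
  \<open>H (t + \<omega>) + H (t - \<omega>) - 2 H t = V' (t + H t)\<close> for every real \<open>t\<close>, not only for \<open>t \<in> \<omega> \<int>\<close>.
  Differentiating in \<open>t\<close> shows that the sliding mode \<open>\<xi>\<^sub>n = 1 + H' (n \<omega>)\<close> is annihilated by the
  Hessian.  It is bounded, because \<open>H\<close> is a trigonometric series whose coefficients beat any power
  of the frequencies (\<open>A_space_orbit_derivative\<close>).

  The sliding mode is not small: \<open>H'\<close> is an absolutely convergent trigonometric series without
  constant term, and by the Diophantine condition none of its frequencies is resonant with \<open>\<omega>\<close>, so
  the means of \<open>H' (n \<omega>)\<close> over \<open>0 \<le> n < N\<close> tend to \<open>0\<close> (\<open>trig_series_mean_tendsto_zero\<close>) and those
  of \<open>\<xi>\<close> tend to \<open>1\<close>.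

  A bounded element of the kernel with nonzero mean excludes a bounded inverse
  (\<open>fk_hessian_not_invertible_if_nonvanishing_mean\<close>).  The truncation of \<open>\<xi>\<close> to \<open>0 \<le> n < N\<close> has norm
  at least of order \<open>\<surd>N\<close> by the Cauchy-Schwarz inequality, whereas its image under the
  nearest-neighbour operator lives on the four sites next to the ends and stays bounded.
\<close>

section \<open>Absolutely convergent trigonometric series on the line\<close>

lemma cmod_cis_minus_linear_le: "cmod (cis x - 1 - \<i> * x) \<le> x\<^sup>2 / 2"
  using iexp_approx1[of x 1] by (simp add: cis_conv_exp power2_eq_square diff_diff_eq)

text \<open>
  The second moment of the coefficients controls the remainder of the first-order Taylor
  expansion of every term at once, so termwise differentiation is justified by a single estimate
  of order \<open>s\<^sup>2\<close>, without ordering the index set.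
\<close>

lemma trig_series_has_derivative:
  fixes a :: "'k \<Rightarrow> complex" and l :: "'k \<Rightarrow> real"
  assumes a: "(\<lambda>k. cmod (a k)) summable_on A"
    and al2: "(\<lambda>k. cmod (a k) * (l k)\<^sup>2) summable_on A"
    and G: "\<And>t. ((\<lambda>k. a k * cis (l k * t)) has_sum G t) A"
    and D: "((\<lambda>k. \<i> * l k * a k * cis (l k * t)) has_sum D) A"
  shows "(G has_vector_derivative D) (at t)"
proof -
  define C where "C = (\<Sum>\<^sub>\<infinity>k\<in>A. cmod (a k) * (l k)\<^sup>2)"
  have remainder: "cmod (G (t + s) - G t - s *\<^sub>R D) \<le> C * (s\<^sup>2 / 2)" for s
  proof (rule norm_infsum_le)
    have "((\<lambda>k. a k * cis (l k * (t + s)) + (- 1) * (a k * cis (l k * t))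
             + (- of_real s) * (\<i> * l k * a k * cis (l k * t)))
            has_sum (G (t + s) + (- 1) * G t + (- of_real s) * D)) A"
      by (intro has_sum_add has_sum_cmult_right G D)
    then show "((\<lambda>k. a k * cis (l k * t) * (cis (l k * s) - 1 - \<i> * complex_of_real (l k * s)))
            has_sum (G (t + s) - G t - s *\<^sub>R D)) A"
      by (simp add: scaleR_conv_of_real cis_mult[symmetric] algebra_simps)
    show "((\<lambda>k. cmod (a k) * (l k)\<^sup>2 * (s\<^sup>2 / 2)) has_sum (C * (s\<^sup>2 / 2))) A"
      unfolding C_def by (intro has_sum_cmult_left has_sum_infsum al2)
    fix k
    show "cmod (a k * cis (l k * t) * (cis (l k * s) - 1 - \<i> * complex_of_real (l k * s)))
            \<le> cmod (a k) * (l k)\<^sup>2 * (s\<^sup>2 / 2)"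
      using mult_left_mono[OF cmod_cis_minus_linear_le[of "l k * s"], of "cmod (a k)"]
      by (simp add: norm_mult power_mult_distrib mult.assoc del: of_real_mult)
  qed
  have "(\<lambda>s. norm (G (t + s) - G t - s *\<^sub>R D) / norm s) \<midarrow>0\<rightarrow> 0"
  proof (rule Lim_null_comparison)
    show "\<forall>\<^sub>F s in at 0. norm (norm (G (t + s) - G t - s *\<^sub>R D) / norm s) \<le> C / 2 * \<bar>s\<bar>"
    proof (rule eventually_at_topological[THEN iffD2], intro exI[of _ UNIV] conjI ballI impI)
      fix s :: real assume "s \<noteq> 0"
      then show "norm (norm (G (t + s) - G t - s *\<^sub>R D) / norm s) \<le> C / 2 * \<bar>s\<bar>"
        using remainder[of s] by (simp add: divide_le_eq mult.assoc power2_eq_square)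
    qed auto
    show "(\<lambda>s. C / 2 * \<bar>s\<bar>) \<midarrow>0\<rightarrow> 0"
      by (auto intro!: tendsto_eq_intros)
  qed
  then show ?thesis
    unfolding has_vector_derivative_def has_derivative_at
    by (auto intro: bounded_linear_scaleR_left)
qed

text \<open>
  This is Weyl's averaging argument: the means of each nonresonant term are geometric sums, hence
  bounded before division by \<open>N\<close>, and finitely many terms carry all but an arbitrarily small part
  of the total mass, which dominates the contribution of the rest uniformly in \<open>N\<close>.
\<close>

lemma trig_series_mean_tendsto_zero:
  fixes b :: "'k \<Rightarrow> complex" and l :: "'k \<Rightarrow> real" and F :: "nat \<Rightarrow> complex"
  assumes b: "(\<lambda>k. cmod (b k)) summable_on A"
    and F: "\<And>n. ((\<lambda>k. b k * cis (l k) ^ n) has_sum F n) A"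
    and nonresonant: "\<And>k. k \<in> A \<Longrightarrow> b k \<noteq> 0 \<Longrightarrow> cis (l k) \<noteq> 1"
  shows "(\<lambda>N. (\<Sum>n<N. F n) / of_nat N) \<longlonglongrightarrow> 0"
proof (rule LIMSEQ_I)
  fix r :: real assume r: "r > 0"
  obtain S where S: "finite S" "S \<subseteq> A"
      and close: "dist (\<Sum>k\<in>S. cmod (b k)) (\<Sum>\<^sub>\<infinity>k\<in>A. cmod (b k)) \<le> r / 2"
    using infsum_finite_approximation[OF b, of "r / 2"] r by auto
  have tail: "(\<Sum>\<^sub>\<infinity>k\<in>A - S. cmod (b k)) \<le> r / 2"
    using close S abs_ge_minus_self[of "(\<Sum>k\<in>S. cmod (b k)) - (\<Sum>\<^sub>\<infinity>k\<in>A. cmod (b k))"]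
      infsum_Diff[OF b _ S(2)] by (simp add: dist_real_def)
  define C where "C = (\<Sum>k\<in>S. cmod (b k) * (2 / cmod (1 - cis (l k))))"
  have rest: "cmod (F n - (\<Sum>k\<in>S. b k * cis (l k) ^ n)) \<le> r / 2" for n
  proof -
    have "((\<lambda>k. b k * cis (l k) ^ n) has_sum (F n - (\<Sum>k\<in>S. b k * cis (l k) ^ n))) (A - S)"
      by (rule has_sum_Diff[OF F _ S(2)]) (use S in simp)
    moreover have "((\<lambda>k. cmod (b k)) has_sum (\<Sum>\<^sub>\<infinity>k\<in>A - S. cmod (b k))) (A - S)"
      by (intro has_sum_infsum summable_on_subset_banach[OF b]) auto
    ultimately have "cmod (F n - (\<Sum>k\<in>S. b k * cis (l k) ^ n)) \<le> (\<Sum>\<^sub>\<infinity>k\<in>A - S. cmod (b k))"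
      by (rule norm_infsum_le) (simp add: norm_mult norm_power)
    then show ?thesis using tail by simp
  qed
  have head: "cmod (\<Sum>n<N. \<Sum>k\<in>S. b k * cis (l k) ^ n) \<le> C" for N
  proof -
    have "(\<Sum>n<N. \<Sum>k\<in>S. b k * cis (l k) ^ n) = (\<Sum>k\<in>S. b k * (\<Sum>n<N. cis (l k) ^ n))"
      by (subst sum.swap) (simp add: sum_distrib_left)
    also have "cmod \<dots> \<le> C"
      unfolding C_def
    proof (rule sum_norm_le)
      fix k assume k: "k \<in> S"
      show "cmod (b k * (\<Sum>n<N. cis (l k) ^ n)) \<le> cmod (b k) * (2 / cmod (1 - cis (l k)))"
      proof (cases "b k = 0")
        case False
        then have "cis (l k) \<noteq> 1" using nonresonant k S by auto
        moreover have "cmod (1 - cis (l k) ^ N) \<le> 2"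
          using norm_triangle_ineq4[of 1 "cis (l k) ^ N"] by (simp add: norm_power)
        ultimately show ?thesis
          by (simp add: sum_gp_strict norm_mult norm_divide mult_left_mono divide_right_mono)
      qed simp
    qed
    finally show ?thesis .
  qed
  have mean: "cmod (\<Sum>n<N. F n) \<le> C + N * (r / 2)" for N
  proof -
    have "(\<Sum>n<N. F n) = (\<Sum>n<N. \<Sum>k\<in>S. b k * cis (l k) ^ n)
            + (\<Sum>n<N. F n - (\<Sum>k\<in>S. b k * cis (l k) ^ n))"
      by (simp add: sum_subtractf)
    also have "cmod \<dots> \<le> C + (\<Sum>n<N. r / 2)"
      by (intro norm_triangle_mono head sum_norm_le rest)
    finally show ?thesis by simp
  qed
  obtain N0 :: nat where N0: "N0 > 2 * C / r" using reals_Archimedean2 by blast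
  show "\<exists>no. \<forall>N\<ge>no. norm ((\<Sum>n<N. F n) / of_nat N - 0) < r"
  proof (intro exI allI impI)
    fix N assume N: "N \<ge> Suc N0"
    then have "real N > 2 * C / r" using N0 by linarith
    then have "2 * C < r * N" using r by (simp add: field_simps)
    moreover have "real N > 0" using N by simp
    ultimately show "norm ((\<Sum>n<N. F n) / of_nat N - 0) < r"
      using mean[of N] by (simp add: norm_divide divide_less_eq field_simps)
  qed
qed

section \<open>Functions on the torus along an orbit\<close>

text \<open>
  Since \<open>\<alpha> \<in> [0,1]\<^sup>N\<close> and all weights are at least \<open>1\<close>, the frequency of a mode along the flow is
  dominated by the quantity in the exponent of the analytic norm.
\<close>

lemma abs_kdot_le_knorm:
  assumes "\<eta> > 0" "\<And>j. 0 \<le> \<alpha> j \<and> \<alpha> j \<le> 1"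
  shows "\<bar>kdot k \<alpha>\<bar> \<le> knorm \<eta> k"
proof -
  have "\<bar>real_of_int (k j) * \<alpha> j\<bar> \<le> jweight j powr \<eta> * real_of_int \<bar>k j\<bar>" for j
  proof -
    have "\<bar>\<alpha> j\<bar> \<le> 1" "1 \<le> jweight j powr \<eta>"
      using assms by (auto simp: jweight_def intro: ge_one_powr_ge_zero)
    then have "\<bar>\<alpha> j\<bar> * \<bar>real_of_int (k j)\<bar> \<le> jweight j powr \<eta> * \<bar>real_of_int (k j)\<bar>"
      by (intro mult_right_mono) auto
    then show ?thesis by (simp add: abs_mult mult.commute)
  qed
  then show ?thesis
    unfolding kdot_def knorm_def by (intro order.trans[OF sum_abs] sum_mono)
qed

text \<open>
  The exponential weight of the norm absorbs the first two powers of the frequency; the explicit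
  factors \<open>1 / \<rho>\<close> and \<open>2 / \<rho>\<^sup>2\<close> come from the quadratic Taylor bound for the exponential.
\<close>

lemma A_space_weighted_summable:
  assumes "\<eta> > 0" "\<rho> > 0" "\<And>j. 0 \<le> \<alpha> j \<and> \<alpha> j \<le> 1" "g \<in> A_space \<eta> \<rho>"
  shows "(\<lambda>k. cmod (fourier_coeff g k)) summable_on Zfin"
    and "(\<lambda>k. cmod (fourier_coeff g k) * \<bar>kdot k \<alpha>\<bar>) summable_on Zfin"
    and "(\<lambda>k. cmod (fourier_coeff g k) * (kdot k \<alpha>)\<^sup>2) summable_on Zfin"
proof -
  let ?c = "\<lambda>k. cmod (fourier_coeff g k)"
  have weighted: "(\<lambda>k. ?c k * exp (\<rho> * knorm \<eta> k)) summable_on Zfin"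
    using assms(4) by (simp add: A_space_def)
  have bounded_weight: "(\<lambda>k. ?c k * w k) summable_on Zfin"
    if w: "\<And>k. 0 \<le> w k" "\<And>k. w k \<le> M * exp (\<rho> * knorm \<eta> k)" for w :: "(nat \<Rightarrow> int) \<Rightarrow> real" and M
  proof (rule summable_on_comparison_test)
    show "(\<lambda>k. M * (?c k * exp (\<rho> * knorm \<eta> k))) summable_on Zfin"
      by (intro summable_on_cmult_right weighted)
    show "?c k * w k \<le> M * (?c k * exp (\<rho> * knorm \<eta> k))" for k
      using mult_left_mono[OF w(2)[of k], of "?c k"] by (simp add: algebra_simps)
  qed (use w in simp)
  have exp_ge: "1 + \<rho> * \<bar>kdot k \<alpha>\<bar> + (\<rho> * \<bar>kdot k \<alpha>\<bar>)\<^sup>2 / 2 \<le> exp (\<rho> * knorm \<eta> k)" for k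
  proof -
    have "1 + \<rho> * \<bar>kdot k \<alpha>\<bar> + (\<rho> * \<bar>kdot k \<alpha>\<bar>)\<^sup>2 / 2 \<le> exp (\<rho> * \<bar>kdot k \<alpha>\<bar>)"
      using assms(2) by (intro exp_lower_Taylor_quadratic) simp
    also have "\<dots> \<le> exp (\<rho> * knorm \<eta> k)"
      using assms(2) abs_kdot_le_knorm[OF assms(1,3)] by simp
    finally show ?thesis .
  qed
  show "?c summable_on Zfin"
  proof -
    have "1 \<le> exp (\<rho> * knorm \<eta> k)" for k
      using exp_ge[of k] assms(2) zero_le_power2[of "\<rho> * \<bar>kdot k \<alpha>\<bar>"]
        mult_nonneg_nonneg[of \<rho> "\<bar>kdot k \<alpha>\<bar>"] by linarith
    then show ?thesis
      using bounded_weight[of "\<lambda>_. 1" 1] by simp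
  qed
  show "(\<lambda>k. ?c k * \<bar>kdot k \<alpha>\<bar>) summable_on Zfin"
  proof (rule bounded_weight[where M = "1 / \<rho>"])
    fix k show "\<bar>kdot k \<alpha>\<bar> \<le> 1 / \<rho> * exp (\<rho> * knorm \<eta> k)"
    proof -
      have "\<rho> * \<bar>kdot k \<alpha>\<bar> \<le> exp (\<rho> * knorm \<eta> k)"
        using exp_ge[of k] zero_le_power2[of "\<rho> * \<bar>kdot k \<alpha>\<bar>"] by linarith
      then show ?thesis using assms(2) by (simp add: field_simps)
    qed
  qed simp
  show "(\<lambda>k. ?c k * (kdot k \<alpha>)\<^sup>2) summable_on Zfin"
  proof (rule bounded_weight[where M = "2 / \<rho>\<^sup>2"])
    fix k
    have "0 \<le> \<rho> * \<bar>kdot k \<alpha>\<bar>" using assms(2) by simp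
    then have "(\<rho> * \<bar>kdot k \<alpha>\<bar>)\<^sup>2 / 2 \<le> exp (\<rho> * knorm \<eta> k)"
      using exp_ge[of k] by linarith
    then show "(kdot k \<alpha>)\<^sup>2 \<le> 2 / \<rho>\<^sup>2 * exp (\<rho> * knorm \<eta> k)"
      using assms(2) by (simp add: power_mult_distrib field_simps)
  qed simp
qed

lemma kdot_scale: "kdot k (\<lambda>j. t * x j) = kdot k x * t"
  by (simp add: kdot_def sum_distrib_left mult_ac)

text \<open>
  \<open>D\<close> is kept as a complex series, although it is the derivative of a real function: boundedness
  and the ergodic means are both read off from its coefficients.
\<close>

lemma A_space_orbit_derivative:
  fixes g :: "(nat \<Rightarrow> real) \<Rightarrow> real"
  assumes "\<eta> > 0" "\<rho> > 0" "\<And>j. 0 \<le> \<alpha> j \<and> \<alpha> j \<le> 1" "cplx g \<in> A_space \<eta> \<rho>"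
  obtains D where
    "\<And>t. ((\<lambda>k. \<i> * complex_of_real (kdot k \<alpha>) * fourier_coeff (cplx g) k
              * cis (kdot k \<alpha> * t)) has_sum D t) Zfin"
    "\<And>t. ((\<lambda>s. g (\<lambda>j. s * \<alpha> j)) has_real_derivative Re (D t)) (at t)"
    "bounded (range D)"
proof
  let ?c = "fourier_coeff (cplx g)"
  define d where "d t k = \<i> * complex_of_real (kdot k \<alpha>) * ?c k * cis (kdot k \<alpha> * t)" for t k
  define D where "D t = infsum (d t) Zfin" for t
  note sm = A_space_weighted_summable[OF assms]
  have absd: "(\<lambda>k. cmod (d t k)) summable_on Zfin" for t
    using sm(2) by (simp add: d_def norm_mult mult.commute)
  have hs: "(d t has_sum D t) Zfin" for t
    unfolding D_def using absd[of t] by (rule has_sum_infsum[OF abs_summable_summable])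
  then show "((\<lambda>k. \<i> * complex_of_real (kdot k \<alpha>) * ?c k * cis (kdot k \<alpha> * t)) has_sum D t) Zfin" for t
    by (simp add: d_def[abs_def])
  have "((\<lambda>s. complex_of_real (g (\<lambda>j. s * \<alpha> j))) has_vector_derivative D t) (at t)" for t
  proof (rule trig_series_has_derivative[where A = Zfin and a = ?c and l = "\<lambda>k. kdot k \<alpha>"])
    fix s
    have "((\<lambda>k. ?c k * cis (kdot k (\<lambda>j. s * \<alpha> j))) has_sum cplx g (\<lambda>j. s * \<alpha> j)) Zfin"
      using assms(4) unfolding A_space_def by blast
    then show "((\<lambda>k. ?c k * cis (kdot k \<alpha> * s)) has_sum cplx g (\<lambda>j. s * \<alpha> j)) Zfin"
      by (simp add: kdot_scale)
  qed (use sm hs in \<open>simp_all add: d_def[abs_def]\<close>)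
  from bounded_linear.has_vector_derivative[OF bounded_linear_Re this]
  show "((\<lambda>s. g (\<lambda>j. s * \<alpha> j)) has_real_derivative Re (D t)) (at t)" for t
    by (simp add: has_real_derivative_iff_has_vector_derivative)
  have "cmod (D t) \<le> (\<Sum>\<^sub>\<infinity>k\<in>Zfin. cmod (?c k) * \<bar>kdot k \<alpha>\<bar>)" for t
    by (rule norm_infsum_le[OF hs has_sum_infsum[OF sm(2)]]) (simp add: d_def norm_mult)
  then show "bounded (range D)" unfolding bounded_iff by blast
qed

section \<open>Nonresonance\<close>

lemma diophantine_nonresonant:
  assumes "diophantine \<alpha> \<omega> \<tau> \<nu>" "k \<in> Zfin" "k \<noteq> (\<lambda>_. 0)"
  shows "cis (kdot k \<alpha> * \<omega>) \<noteq> 1"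
proof
  assume "cis (kdot k \<alpha> * \<omega>) = 1"
  then have "cos (kdot k \<alpha> * \<omega>) = 1" by (simp add: complex_eq_iff)
  then obtain n :: int where "kdot k \<alpha> * \<omega> = real_of_int n * 2 * pi"
    using cos_one_2pi_int[of "kdot k \<alpha> * \<omega>"] by auto
  moreover have "\<bar>\<omega> * kdot k \<alpha> - 2 * real_of_int n * pi\<bar> \<ge>
          \<nu> / (\<Prod>j | k j \<noteq> 0. 1 + jweight j powr (1 + \<tau>) * real_of_int \<bar>k j\<bar> powr (1 + \<tau>))"
    and "\<nu> > 0"
    using assms unfolding diophantine_def by auto
  moreover have "(\<Prod>j | k j \<noteq> 0. 1 + jweight j powr (1 + \<tau>) * real_of_int \<bar>k j\<bar> powr (1 + \<tau>)) > 0"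
    by (intro prod_pos) (auto intro: add_pos_nonneg)
  ultimately show False
    by (simp add: mult.commute divide_le_0_iff)
qed

section \<open>Equilibria and the Hessian\<close>

text \<open>
  The directional derivative is defined by differentiation at the base point of each orbit;
  translating the base point gives the derivative of the restriction to the line everywhere.
\<close>

lemma orbit_has_dir_deriv:
  fixes g :: "(nat \<Rightarrow> real) \<Rightarrow> real"
  assumes "dir_differentiable \<alpha> g"
  shows "((\<lambda>t. g (\<lambda>j. t * \<alpha> j)) has_real_derivative dir_deriv \<alpha> g (\<lambda>j. t * \<alpha> j)) (at t)"
proof -
  have "((\<lambda>s. g (along \<alpha> s (\<lambda>j. t * \<alpha> j))) has_vector_derivative dir_deriv \<alpha> g (\<lambda>j. t * \<alpha> j)) (at 0)"
    using assms unfolding dir_differentiable_def dir_deriv_def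
    by (simp add: vector_derivative_works)
  then have "((\<lambda>s. g (\<lambda>j. (s + t) * \<alpha> j)) has_real_derivative dir_deriv \<alpha> g (\<lambda>j. t * \<alpha> j)) (at 0)"
    by (simp add: along_def has_real_derivative_iff_has_vector_derivative algebra_simps)
  then show ?thesis
    using DERIV_shift[of "\<lambda>t. g (\<lambda>j. t * \<alpha> j)" _ 0 t] by simp
qed

lemma fk_equilibrium_if_force_balance:
  assumes V: "\<And>n. (V has_real_derivative V' (u n)) (at (u n))"
    and balance: "\<And>n. u (n + 1) + u (n - 1) - 2 * u n = V' (u n)"
  shows "fk_equilibrium V u"
  unfolding fk_equilibrium_def
proof
  fix n
  have "((\<lambda>x. (1/2 * (u (n - 1) - x)\<^sup>2 + V (u (n - 1))) + (1/2 * (x - u (n + 1))\<^sup>2 + V x))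
          has_real_derivative (- (u (n - 1) - u n) + ((u n - u (n + 1)) + V' (u n)))) (at (u n))"
    by (auto intro!: derivative_eq_intros V simp: field_simps)
  also have "- (u (n - 1) - u n) + ((u n - u (n + 1)) + V' (u n)) = 0"
    using balance[of n] by simp
  finally show "((\<lambda>x. \<Sum>m\<in>{n - 1, n}. fk_site V (u(n := x)) m) has_real_derivative 0) (at (u n))"
    by (simp add: fk_site_def)
qed

lemma ell2_norm_power2: "(ell2_norm x)\<^sup>2 = (\<Sum>\<^sub>\<infinity>n. (cmod (x n))\<^sup>2)"
  unfolding ell2_norm_def by (intro real_sqrt_pow2 infsum_nonneg) simp

lemma ell2_finite_support:
  assumes "finite B" "\<And>n. n \<notin> B \<Longrightarrow> x n = 0"
  shows "x \<in> ell2" and "(ell2_norm x)\<^sup>2 = (\<Sum>n\<in>B. (cmod (x n))\<^sup>2)"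
proof -
  have "((\<lambda>n. (cmod (x n))\<^sup>2) has_sum (\<Sum>n\<in>B. (cmod (x n))\<^sup>2)) UNIV"
    by (rule has_sum_finite_neutralI) (use assms in auto)
  then show "x \<in> ell2" and "(ell2_norm x)\<^sup>2 = (\<Sum>n\<in>B. (cmod (x n))\<^sup>2)"
    unfolding ell2_def ell2_norm_power2 by (auto intro: has_sum_imp_summable infsumI)
qed

lemma ell2_shift:
  assumes "x \<in> ell2"
  shows "((\<lambda>n. (cmod (x (n + m)))\<^sup>2) has_sum (ell2_norm x)\<^sup>2) UNIV"
proof -
  have "((\<lambda>n. (cmod (x n))\<^sup>2) has_sum (ell2_norm x)\<^sup>2) UNIV"
    using assms unfolding ell2_norm_power2 ell2_def by simp
  moreover have "bij_betw (\<lambda>n :: int. n + m) UNIV UNIV"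
    by (rule bij_betwI[of _ _ _ "\<lambda>n. n - m"]) auto
  ultimately show ?thesis
    by (subst has_sum_reindex_bij_betw)
qed

lemma cmod_fk_hessian_le:
  "cmod (fk_hessian V u x n) \<le> cmod (x (n - 1))
     + cmod (complex_of_real (2 + deriv (deriv V) (u n)) * x n) + cmod (x (n + 1))"
  unfolding fk_hessian_def
  using norm_triangle_ineq4[of "- x (n - 1) + complex_of_real (2 + deriv (deriv V) (u n)) * x n" "x (n + 1)"]
    norm_triangle_ineq[of "- x (n - 1)" "complex_of_real (2 + deriv (deriv V) (u n)) * x n"]
  unfolding norm_minus_cancel by linarith

lemma fk_hessian_bounded_linear:
  assumes "\<And>n. \<bar>2 + deriv (deriv V) (u n)\<bar> \<le> M"
  shows "ell2_bounded_linear (fk_hessian V u)"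
proof -
  let ?T = "fk_hessian V u"
  have bound: "?T x \<in> ell2 \<and> ell2_norm (?T x) \<le> sqrt (3 * (2 + M\<^sup>2)) * ell2_norm x"
    if x: "x \<in> ell2" for x
  proof -
    let ?w = "\<lambda>n. 3 * ((cmod (x (n + - 1)))\<^sup>2 + M\<^sup>2 * (cmod (x (n + 0)))\<^sup>2 + (cmod (x (n + 1)))\<^sup>2)"
    have w: "(?w has_sum 3 * ((ell2_norm x)\<^sup>2 + M\<^sup>2 * (ell2_norm x)\<^sup>2 + (ell2_norm x)\<^sup>2)) UNIV"
      by (intro has_sum_cmult_right has_sum_add ell2_shift x)
    have pointwise: "(cmod (?T x n))\<^sup>2 \<le> ?w n" for n
    proof -
      define p q r where "p = cmod (x (n - 1))" and "q = M * cmod (x n)" and "r = cmod (x (n + 1))"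
      have "cmod (?T x n) \<le> cmod (x (n - 1))
              + cmod (complex_of_real (2 + deriv (deriv V) (u n)) * x n) + cmod (x (n + 1))"
        by (rule cmod_fk_hessian_le)
      also have "\<dots> \<le> p + q + r"
        using mult_right_mono[OF assms[of n], of "cmod (x n)"]
        by (simp only: p_def q_def r_def norm_mult norm_of_real) simp
      finally have "(cmod (?T x n))\<^sup>2 \<le> (p + q + r)\<^sup>2"
        by (intro power_mono) auto
      also have "\<dots> \<le> 3 * (p\<^sup>2 + q\<^sup>2 + r\<^sup>2)"
        using sum_squares_bound[of p q] sum_squares_bound[of q r] sum_squares_bound[of p r]
        by (simp add: power2_eq_square algebra_simps)
      finally show ?thesis by (simp add: p_def q_def r_def power_mult_distrib)
    qed
    have mem: "?T x \<in> ell2"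
      unfolding ell2_def
      using summable_on_comparison_test[OF has_sum_imp_summable[OF w], of "\<lambda>n. (cmod (?T x n))\<^sup>2"]
        pointwise by simp
    have "(ell2_norm (?T x))\<^sup>2 \<le> 3 * (2 + M\<^sup>2) * (ell2_norm x)\<^sup>2"
      using has_sum_mono[OF ell2_shift[OF mem, of 0] w] pointwise by (simp add: algebra_simps)
    then have "ell2_norm (?T x) \<le> sqrt (3 * (2 + M\<^sup>2) * (ell2_norm x)\<^sup>2)"
      by (rule real_le_rsqrt)
    also have "\<dots> = sqrt (3 * (2 + M\<^sup>2)) * ell2_norm x"
      by (simp add: real_sqrt_mult ell2_norm_def infsum_nonneg)
    finally show ?thesis using mem by simp
  qed
  show ?thesis
    unfolding ell2_bounded_linear_def
  proof (intro conjI)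
    show "\<exists>K. \<forall>x\<in>ell2. ell2_norm (?T x) \<le> K * ell2_norm x"
      using bound by blast
  qed (use bound in \<open>auto simp: fk_hessian_def algebra_simps fun_eq_iff\<close>)
qed

text \<open>
  Truncated to \<open>0 \<le> n < N\<close>, the kernel element has an image bounded independently of \<open>N\<close>, since the
  image only sees the two cuts.  A bounded inverse would thus bound the square sums of \<open>\<xi>\<close> over
  \<open>0 \<le> n < N\<close> independently of \<open>N\<close>, which by the Cauchy-Schwarz inequality forces the means of \<open>\<xi>\<close>
  to decay like \<open>1 / \<surd>N\<close>.
\<close>

lemma fk_hessian_not_invertible_if_nonvanishing_mean:
  fixes \<xi> :: "int \<Rightarrow> real"
  assumes M: "\<And>n. \<bar>2 + deriv (deriv V) (u n)\<bar> \<le> M"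
    and B: "\<And>n. \<bar>\<xi> n\<bar> \<le> B"
    and kernel: "\<And>n. fk_hessian V u (\<lambda>n. complex_of_real (\<xi> n)) n = 0"
    and mean: "(\<lambda>N. (\<Sum>i<N. \<xi> (int i)) / N) \<longlonglongrightarrow> L" and L: "L \<noteq> 0"
  shows "\<not> ell2_invertible (fk_hessian V u)"
proof
  let ?T = "fk_hessian V u"
  assume "ell2_invertible ?T"
  then obtain S K where S: "\<And>x. x \<in> ell2 \<Longrightarrow> S (?T x) = x"
      and K: "\<And>y. y \<in> ell2 \<Longrightarrow> ell2_norm (S y) \<le> K * ell2_norm y"
    unfolding ell2_invertible_def ell2_bounded_linear_def by blast
  have B0: "B \<ge> 0" using B[of 0] by linarith
  have M0: "M \<ge> 0" using M[of 0] by linarith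
  define C where "C = K\<^sup>2 * (4 * ((2 + M) * B)\<^sup>2)"
  have square_sum: "(\<Sum>i<N. (\<xi> (int i))\<^sup>2) \<le> C" for N :: nat
  proof -
    define x where "x n = (if 0 \<le> n \<and> n < int N then complex_of_real (\<xi> n) else 0)" for n
    let ?I = "int ` {..<N}" and ?E = "{- 1, 0, int N - 1, int N}"
    have "n \<in> ?I \<longleftrightarrow> 0 \<le> n \<and> n < int N" for n
      by (metis imageE imageI lessThan_iff of_nat_0_le_iff of_nat_less_iff zero_le_imp_eq_int)
    then have supp: "x n = 0" if "n \<notin> ?I" for n
      using that by (auto simp: x_def)
    note x = ell2_finite_support[of ?I x, OF _ supp, simplified]
    have x_norm: "(ell2_norm x)\<^sup>2 = (\<Sum>i<N. (\<xi> (int i))\<^sup>2)"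
      using x(2) by (simp add: sum.reindex x_def)
    have Tx_supp: "?T x n = 0" if "n \<notin> ?E" for n
    proof -
      have "n < - 1 \<or> n > int N \<or> 1 \<le> n \<and> n < int N - 1" using that by simp presburger
      then consider "n < - 1" | "n > int N" | "1 \<le> n" "n < int N - 1" by blast
      then show ?thesis
        using kernel[of n] by cases (simp_all add: fk_hessian_def x_def)
    qed
    have x_le: "cmod (x n) \<le> B" for n
      using B B0 by (simp add: x_def)
    have Tx_le: "cmod (?T x n) \<le> (2 + M) * B" for n
    proof -
      have "cmod (?T x n) \<le> cmod (x (n - 1))
              + cmod (complex_of_real (2 + deriv (deriv V) (u n)) * x n) + cmod (x (n + 1))"
        by (rule cmod_fk_hessian_le)
      also have "\<dots> \<le> B + M * B + B"
        unfolding norm_mult norm_of_real by (intro add_mono mult_mono x_le M M0) simp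
      finally show ?thesis by (simp add: algebra_simps)
    qed
    note Tx = ell2_finite_support[of ?E "?T x", OF _ Tx_supp]
    have "(ell2_norm (?T x))\<^sup>2 = (\<Sum>n\<in>?E. (cmod (?T x n))\<^sup>2)"
      by (rule Tx(2)) auto
    also have "\<dots> \<le> of_nat (card ?E) * ((2 + M) * B)\<^sup>2"
      by (intro sum_bounded_above power_mono Tx_le) simp
    also have "\<dots> \<le> 4 * ((2 + M) * B)\<^sup>2"
      by (intro mult_right_mono) (auto simp: card_insert_if)
    finally have Tx_norm: "(ell2_norm (?T x))\<^sup>2 \<le> 4 * ((2 + M) * B)\<^sup>2" .
    have "ell2_norm x \<le> K * ell2_norm (?T x)"
      using K[OF Tx(1)] S[OF x(1)] by auto
    then have "(ell2_norm x)\<^sup>2 \<le> (K * ell2_norm (?T x))\<^sup>2"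
      by (intro power_mono) (simp_all add: ell2_norm_def infsum_nonneg)
    also have "\<dots> \<le> C"
      unfolding C_def power_mult_distrib[of K] by (intro mult_left_mono Tx_norm) simp
    finally show ?thesis by (simp add: x_norm)
  qed
  have "L\<^sup>2 \<le> 0"
  proof (rule LIMSEQ_le)
    show "(\<lambda>N. ((\<Sum>i<N. \<xi> (int i)) / N)\<^sup>2) \<longlonglongrightarrow> L\<^sup>2"
      by (intro tendsto_power mean)
    show "(\<lambda>N. C / real N) \<longlonglongrightarrow> 0"
      by (rule lim_const_over_n)
    have "((\<Sum>i<N. \<xi> (int i)) / N)\<^sup>2 \<le> C / N" if "N \<ge> 1" for N :: nat
    proof -
      have "(\<Sum>i<N. \<xi> (int i))\<^sup>2 \<le> (\<Sum>i<N. (\<xi> (int i))\<^sup>2) * N"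
        using Cauchy_Schwarz_ineq_sum[of "\<lambda>i. \<xi> (int i)" "\<lambda>_. 1" "{..<N}"] by simp
      also have "\<dots> \<le> C * N"
        by (intro mult_right_mono square_sum) simp
      finally show ?thesis
        using that by (simp add: power_divide divide_simps power2_eq_square)
    qed
    then show "\<exists>N0. \<forall>N\<ge>N0. ((\<Sum>i<N. \<xi> (int i)) / N)\<^sup>2 \<le> C / N" by blast
  qed
  then show False using L by simp
qed

theorem theorem2:
  fixes \<eta> \<omega> \<rho>0 \<iota> \<tau> \<nu> Np Nm c \<epsilon> \<epsilon>s C1 C3 :: real
    and \<alpha> :: "nat \<Rightarrow> real"
    and h V hs :: "(nat \<Rightarrow> real) \<Rightarrow> real"
  assumes "\<eta> > 0"
    and "fk_setting \<eta> \<alpha> \<omega> \<rho>0 \<iota> h V"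
    and "diophantine \<alpha> \<omega> \<tau> \<nu>"
    and "nondegenerate \<eta> \<alpha> \<omega> \<rho>0 Np Nm c h"
    and "kam_constants \<eta> Np Nm c \<tau> \<nu> \<iota> \<rho>0
           (A_norm_m \<eta> \<alpha> 2 (\<rho>0 + A_norm \<eta> \<rho>0 (cplx h) + \<iota>) (cplx (dir_deriv \<alpha> V))) \<epsilon>s C1 C3"
    and "approx_solution \<eta> \<alpha> \<omega> \<rho>0 h V \<epsilon>"
    and "\<epsilon> \<le> \<epsilon>s"
    and "kam_solution \<eta> \<alpha> \<omega> \<rho>0 h V \<epsilon> C1 C3 hs"
  shows "fk_equilibrium (line_potential \<alpha> V) (hull_config \<alpha> \<omega> hs) \<and>
         ell2_bounded_linear (fk_hessian (line_potential \<alpha> V) (hull_config \<alpha> \<omega> hs)) \<and>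
         \<not> ell2_invertible (fk_hessian (line_potential \<alpha> V) (hull_config \<alpha> \<omega> hs)) \<and>
         \<not> phonon_gap (line_potential \<alpha> V) (hull_config \<alpha> \<omega> hs)"
proof -
  let ?V = "line_potential \<alpha> V" and ?u = "hull_config \<alpha> \<omega> hs"
  let ?\<rho>V = "\<rho>0 + A_norm \<eta> \<rho>0 (cplx h) + \<iota>"
  define W where "W t = dir_deriv \<alpha> V (\<lambda>j. t * \<alpha> j)" for t
  define H where "H t = hs (\<lambda>j. t * \<alpha> j)" for t
  have \<alpha>: "\<And>j. 0 \<le> \<alpha> j \<and> \<alpha> j \<le> 1" and \<rho>0: "\<rho>0 / 2 > 0" and diff: "dir_differentiable \<alpha> V"
    and VA: "cplx (dir_deriv \<alpha> V) \<in> A_space \<eta> ?\<rho>V"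
    using assms(2) unfolding fk_setting_def A_space_m_def by auto
  have \<rho>V: "?\<rho>V > 0"
    using assms(2) unfolding fk_setting_def
    by (intro add_pos_pos add_pos_nonneg) (auto simp: A_norm_def intro: infsum_nonneg)
  have hsA: "cplx hs \<in> A_space \<eta> (\<rho>0 / 2)" and solves: "\<And>\<sigma>. equil_err \<alpha> \<omega> V hs \<sigma> = 0"
    using assms(8) unfolding kam_solution_def by auto
  obtain DW where DW: "\<And>t. (W has_real_derivative Re (DW t)) (at t)" and bDW: "bounded (range DW)"
    by (rule A_space_orbit_derivative[where \<alpha> = \<alpha>, OF assms(1) \<rho>V \<alpha> VA, folded W_def]) blast
  obtain DH where DH_sum: "\<And>t. ((\<lambda>k. \<i> * complex_of_real (kdot k \<alpha>) * fourier_coeff (cplx hs) k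
                                    * cis (kdot k \<alpha> * t)) has_sum DH t) Zfin"
      and DH: "\<And>t. (H has_real_derivative Re (DH t)) (at t)" and bDH: "bounded (range DH)"
    by (rule A_space_orbit_derivative[where \<alpha> = \<alpha>, OF assms(1) \<rho>0 \<alpha> hsA, folded H_def]) blast
  have V1: "(?V has_real_derivative W t) (at t)" for t
    using orbit_has_dir_deriv[OF diff] by (simp add: line_potential_def[abs_def] W_def)
  then have "deriv ?V = W" by (intro ext DERIV_imp_deriv)
  then have V2: "deriv (deriv ?V) t = Re (DW t)" for t
    using DW by (simp add: DERIV_imp_deriv)
  have balance: "H (t + \<omega>) + H (t - \<omega>) - 2 * H t = W (t + H t)" for t
    using solves[of "\<lambda>j. t * \<alpha> j"]
    by (simp add: equil_err_def along_def H_def W_def algebra_simps)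
  have u: "?u n = n * \<omega> + H (n * \<omega>)" for n
    by (simp add: hull_config_def H_def)
  have equil: "fk_equilibrium ?V ?u"
  proof (rule fk_equilibrium_if_force_balance[where V' = W])
    show "?u (n + 1) + ?u (n - 1) - 2 * ?u n = W (?u n)" for n
      using balance[of "n * \<omega>"] by (simp add: u algebra_simps)
  qed (rule V1)
  obtain M where "\<And>t. cmod (DW t) \<le> M" using bDW by (auto simp: bounded_iff)
  then have M: "\<bar>2 + deriv (deriv ?V) (?u n)\<bar> \<le> 2 + M" for n
    using abs_Re_le_cmod[of "DW (?u n)"] unfolding V2
    by (intro order.trans[OF abs_triangle_ineq] add_mono) (auto intro: order.trans)
  have linear: "ell2_bounded_linear (fk_hessian ?V ?u)"
    by (rule fk_hessian_bounded_linear[OF M])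
  \<comment> \<open>The sliding mode: the derivative of \<open>t + n \<omega> + H (t + n \<omega>)\<close> in the phase \<open>t\<close> at \<open>t = 0\<close>.\<close>
  define \<xi> where "\<xi> n = 1 + Re (DH (real_of_int n * \<omega>))" for n
  obtain B where "\<And>t. cmod (DH t) \<le> B" using bDH by (auto simp: bounded_iff)
  then have \<xi>_bound: "\<bar>\<xi> n\<bar> \<le> 1 + B" for n
    using abs_Re_le_cmod[of "DH (n * \<omega>)"] unfolding \<xi>_def
    by (intro order.trans[OF abs_triangle_ineq] add_mono) (auto intro: order.trans)
  have shifted: "((\<lambda>t. H (t + s)) has_real_derivative Re (DH (t + s))) (at t)" for s t
    using DH[of "t + s"] by (simp add: DERIV_shift)
  \<comment> \<open>Differentiate the equilibrium equation along the family of equilibria obtained by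
    translating \<open>t\<close>.\<close>
  have linearized: "Re (DH (t + \<omega>)) + Re (DH (t - \<omega>)) - 2 * Re (DH t)
      = Re (DW (t + H t)) * (1 + Re (DH t))" for t
  proof (rule DERIV_unique)
    have "((\<lambda>t. H (t + \<omega>) + H (t + - \<omega>) - 2 * H t) has_real_derivative
            Re (DH (t + \<omega>)) + Re (DH (t + - \<omega>)) - 2 * Re (DH t)) (at t)"
      by (intro DERIV_diff DERIV_add DERIV_cmult DH shifted)
    then show "((\<lambda>t. W (t + H t)) has_real_derivative
            Re (DH (t + \<omega>)) + Re (DH (t - \<omega>)) - 2 * Re (DH t)) (at t)"
      by (simp add: balance)
    show "((\<lambda>t. W (t + H t)) has_real_derivative Re (DW (t + H t)) * (1 + Re (DH t))) (at t)"
      by (rule DERIV_chain2[OF DW]) (intro DERIV_add DERIV_ident DH)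
  qed
  have kernel: "fk_hessian ?V ?u (\<lambda>n. complex_of_real (\<xi> n)) n = 0" for n
  proof -
    have "- \<xi> (n - 1) + (2 + Re (DW (?u n))) * \<xi> n - \<xi> (n + 1) = 0"
      using linearized[of "n * \<omega>"] by (simp add: \<xi>_def u algebra_simps)
    then have "complex_of_real (- \<xi> (n - 1) + (2 + Re (DW (?u n))) * \<xi> n - \<xi> (n + 1)) = 0"
      by (simp only: of_real_0)
    then show ?thesis
      unfolding fk_hessian_def V2 by simp
  qed
  have "(\<lambda>N. (\<Sum>n<N. DH (real n * \<omega>)) / of_nat N) \<longlonglongrightarrow> 0"
  proof (rule trig_series_mean_tendsto_zero)
    let ?b = "\<lambda>k. \<i> * complex_of_real (kdot k \<alpha>) * fourier_coeff (cplx hs) k"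
    show "(\<lambda>k. cmod (?b k)) summable_on Zfin"
      using A_space_weighted_summable(2)[where \<alpha> = \<alpha>, OF assms(1) \<rho>0 \<alpha> hsA]
      by (simp add: norm_mult mult.commute)
    show "((\<lambda>k. ?b k * cis (kdot k \<alpha> * \<omega>) ^ n) has_sum DH (real n * \<omega>)) Zfin" for n
      using DH_sum[of "real n * \<omega>"] by (simp add: Complex.DeMoivre mult_ac)
    \<comment> \<open>Only the constant mode \<open>k = 0\<close> is resonant, and differentiation removes it.\<close>
    show "cis (kdot k \<alpha> * \<omega>) \<noteq> 1" if "k \<in> Zfin" "?b k \<noteq> 0" for k
      using that by (intro diophantine_nonresonant[OF assms(3)]) (auto simp: kdot_def)
  qed
  from tendsto_add[OF tendsto_const[of 1] tendsto_Re[OF this]]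
  have "(\<lambda>N. 1 + Re ((\<Sum>n<N. DH (real n * \<omega>)) / of_nat N)) \<longlonglongrightarrow> 1" by simp
  \<comment> \<open>The two sides differ at \<open>N = 0\<close>, where division by zero yields \<open>0\<close>.\<close>
  moreover have "\<forall>\<^sub>F N in sequentially.
      1 + Re ((\<Sum>n<N. DH (real n * \<omega>)) / of_nat N) = (\<Sum>i<N. \<xi> (int i)) / real N"
    using eventually_gt_at_top[of 0]
    by eventually_elim (simp add: \<xi>_def sum.distrib add_divide_distrib)
  ultimately have mean: "(\<lambda>N. (\<Sum>i<N. \<xi> (int i)) / N) \<longlonglongrightarrow> 1"
    by (rule Lim_transform_eventually)
  have not_inv: "\<not> ell2_invertible (fk_hessian ?V ?u)"
    by (rule fk_hessian_not_invertible_if_nonvanishing_mean[OF M \<xi>_bound kernel mean]) simp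
  then have "\<not> phonon_gap ?V ?u"
    by (simp add: phonon_gap_def ell2_spectrum_def)
  with equil linear not_inv show ?thesis by blast
qed

end
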